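(* Let $G$ be a real Lie group of dimension $n\ge 3$ with Lie algebra $\mathfrak g$ whose derived algebra $\mathfrak g'=[\mathfrak g,\mathfrak g]$ is two-dimensional, and let $(J,g)$ be a left-invariant Hermitian structure on $G$ of Type II, i.e. $J(\mathfrak g')\subseteq\Gamma$, where $\Gamma=(\mathfrak g')^\perp$. Let $\{\mathsf e_1,\mathsf e_2\}$ be an orthonormal basis of $\mathfrak g'$ and let $\mathsf a_1,\mathsf a_2,\mathsf b_1,\mathsf b_2\in\Gamma$ and $f_1,f_2:\Gamma\to\Gamma$ be the structure data of $\mathfrak g$ with respect to this basis (defined in the context). Then $(J,g)$ is Kähler if and only if $f_1=f_2=0$ and $\mathsf b_1=\mathsf a_2$.
   Context: Left-invariant structures are identified with their values on $\mathfrak g$: $g$ corresponds to an inner product $\langle\cdot,\cdot\rangle$ on $\mathfrak g$, and $J$ to a linear map $J:\mathfrak g\to\mathfrak g$ with $J^2=-\mathrm{Id}$. The pair $(J,g)$ is Hermitian if $\langle Jx,Jy\rangle=\langle x,y\rangle$ for all $x,y\in\mathfrak g$ and $J$ is integrable, i.e. $N_J(x,y)=[x,y]+J([Jx,y]+[x,Jy])-[Jx,Jy]=0$ for all $x,y\in\mathfrak g$. It is Kähler if the 2-form $\omega(x,y)=\langle Jx,y\rangle$ is closed, i.e. $d\omega=0$; for left-invariant forms this means $\omega([x,y],z)+\omega([y,z],x)+\omega([z,x],y)=0$ for all $x,y,z\in\mathfrak g$. Structure data. If $\dim\mathfrak g'=2$ then $\mathfrak g$ is solvable and $\mathfrak g'$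 is abelian. Let $\{\mathsf e_1,\mathsf e_2\}$ be an orthonormal basis of $\mathfrak g'$ and $\Gamma$ the orthogonal complement of $\mathfrak g'$ in $\mathfrak g$. There are unique vectors $\mathsf a_1,\mathsf a_2,\mathsf b_1,\mathsf b_2\in\Gamma$ and unique skew-adjoint linear maps $f_1,f_2:\Gamma\to\Gamma$ such that for all $u,v\in\Gamma$ $$[u,\mathsf e_1]=\langle\mathsf a_1,u\rangle\mathsf e_1+\langle\mathsf a_2,u\rangle\mathsf e_2,\qquad [u,\mathsf e_2]=\langle\mathsf b_1,u\rangle\mathsf e_1+\langle\mathsf b_2,u\rangle\mathsf e_2,$$ $$[u,v]=\langle f_1(u),v\rangle\mathsf e_1+\langle f_2(u),v\rangle\mathsf e_2.$$ *)

theory Defs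
  imports "HOL-Analysis.Analysis"
begin

(* A Lie group G with a left-invariant metric enters through its Lie algebra: the type 'a is the
   underlying vector space, a bracket is given as a function on it, and the inner product of the
   class euclidean_space is the left-invariant metric at the identity. *)

locale lie_algebra =
  fixes br :: "'a::real_vector \<Rightarrow> 'a \<Rightarrow> 'a"
  assumes bilinear_br: "bilinear br"
    and br_self: "br x x = 0"
    and jacobi: "br x (br y z) + br y (br z x) + br z (br x y) = 0"

definition derived_algebra :: "('a::real_vector \<Rightarrow> 'a \<Rightarrow> 'a) \<Rightarrow> 'a set" where
  "derived_algebra br = span {br x y | x y. True}"

definition almost_complex :: "('a::real_vector \<Rightarrow> 'a) \<Rightarrow> bool" where
  "almost_complex J \<longleftrightarrow> linear J \<and> (\<forall>x. J (J x) = - x)"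

definition nijenhuis ::
  "('a::real_vector \<Rightarrow> 'a \<Rightarrow> 'a) \<Rightarrow> ('a \<Rightarrow> 'a) \<Rightarrow> 'a \<Rightarrow> 'a \<Rightarrow> 'a" where
  "nijenhuis br J x y = br x y + J (br (J x) y + br x (J y)) - br (J x) (J y)"

definition hermitian :: "('a::real_inner \<Rightarrow> 'a \<Rightarrow> 'a) \<Rightarrow> ('a \<Rightarrow> 'a) \<Rightarrow> bool" where
  "hermitian br J \<longleftrightarrow> almost_complex J \<and> (\<forall>x y. J x \<bullet> J y = x \<bullet> y) \<and>
     (\<forall>x y. nijenhuis br J x y = 0)"

definition fundamental_form :: "('a::real_inner \<Rightarrow> 'a) \<Rightarrow> 'a \<Rightarrow> 'a \<Rightarrow> real" where
  "fundamental_form J x y = J x \<bullet> y"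

(* Exterior derivative of a left-invariant 2-form: in the invariant formula for d the terms
   that differentiate the (constant) values of the form vanish. *)
definition ext_deriv2 ::
  "('a \<Rightarrow> 'a \<Rightarrow> 'a) \<Rightarrow> ('a \<Rightarrow> 'a \<Rightarrow> real) \<Rightarrow> 'a \<Rightarrow> 'a \<Rightarrow> 'a \<Rightarrow> real" where
  "ext_deriv2 br \<omega> x y z = - (\<omega> (br x y) z + \<omega> (br y z) x + \<omega> (br z x) y)"

definition kaehler :: "('a::real_inner \<Rightarrow> 'a \<Rightarrow> 'a) \<Rightarrow> ('a \<Rightarrow> 'a) \<Rightarrow> bool" where
  "kaehler br J \<longleftrightarrow> hermitian br J \<and>
     (\<forall>x y z. ext_deriv2 br (fundamental_form J) x y z = 0)"

abbreviation Gam :: "('a::euclidean_space \<Rightarrow> 'a \<Rightarrow> 'a) \<Rightarrow> 'a set" where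
  "Gam br \<equiv> orthogonal_comp (derived_algebra br)"

definition type_II :: "('a::euclidean_space \<Rightarrow> 'a \<Rightarrow> 'a) \<Rightarrow> ('a \<Rightarrow> 'a) \<Rightarrow> bool" where
  "type_II br J \<longleftrightarrow> J ` derived_algebra br \<subseteq> Gam br"

definition orthonormal_basis2 :: "'a::real_inner set \<Rightarrow> 'a \<Rightarrow> 'a \<Rightarrow> bool" where
  "orthonormal_basis2 S e1 e2 \<longleftrightarrow>
     norm e1 = 1 \<and> norm e2 = 1 \<and> orthogonal e1 e2 \<and> span {e1, e2} = S"

(* A linear map of the subspace S into itself is represented by a function on the ambient
   space; its values outside S are arbitrary and play no role. *)
definition skew_adjoint_on :: "'a::real_inner set \<Rightarrow> ('a \<Rightarrow> 'a) \<Rightarrow> bool" where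
  "skew_adjoint_on S f \<longleftrightarrow> f ` S \<subseteq> S \<and>
     (\<forall>u\<in>S. \<forall>v\<in>S. f (u + v) = f u + f v) \<and>
     (\<forall>c. \<forall>u\<in>S. f (c *\<^sub>R u) = c *\<^sub>R f u) \<and>
     (\<forall>u\<in>S. \<forall>v\<in>S. f u \<bullet> v = - (u \<bullet> f v))"

definition structure_data ::
  "('a::euclidean_space \<Rightarrow> 'a \<Rightarrow> 'a) \<Rightarrow> 'a \<Rightarrow> 'a \<Rightarrow> 'a \<Rightarrow> 'a \<Rightarrow> 'a \<Rightarrow> 'a \<Rightarrow> ('a \<Rightarrow> 'a) \<Rightarrow> ('a \<Rightarrow> 'a) \<Rightarrow> bool"
  where
  "structure_data br e1 e2 a1 a2 b1 b2 f1 f2 \<longleftrightarrow>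
     a1 \<in> Gam br \<and> a2 \<in> Gam br \<and> b1 \<in> Gam br \<and> b2 \<in> Gam br \<and>
     skew_adjoint_on (Gam br) f1 \<and> skew_adjoint_on (Gam br) f2 \<and>
     (\<forall>u\<in>Gam br. br u e1 = (a1 \<bullet> u) *\<^sub>R e1 + (a2 \<bullet> u) *\<^sub>R e2) \<and>
     (\<forall>u\<in>Gam br. br u e2 = (b1 \<bullet> u) *\<^sub>R e1 + (b2 \<bullet> u) *\<^sub>R e2) \<and>
     (\<forall>u\<in>Gam br. \<forall>v\<in>Gam br. br u v = (f1 u \<bullet> v) *\<^sub>R e1 + (f2 u \<bullet> v) *\<^sub>R e2)"

end

(* Write D for the derived algebra and \<Gamma> for its complement. D is abelian: for x in D, ad x is a
   sum of commutators, so its restriction to the two-dimensional D has trace zero. In type II every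
   vector is p + J q + u with p, q in D and u in the largest J-invariant subspace W of \<Gamma>.
   Comparing components in D and in \<Gamma>, integrability gives [J x, J y] = [x, y] for all x, y.
   Evaluating d\<omega> on vectors of the three kinds then shows that the structure is Kaehler iff
   [\<Gamma>, \<Gamma>] = 0 and ad u restricted to D is symmetric for all u in \<Gamma>. *)

theory Submission
  imports Defs
begin

section \<open>Elementary bracket identities\<close>

context lie_algebra
begin

lemmas br_simps = bilinear_ladd[OF bilinear_br] bilinear_radd[OF bilinear_br]
  bilinear_lmul[OF bilinear_br] bilinear_rmul[OF bilinear_br]
  bilinear_lneg[OF bilinear_br] bilinear_rneg[OF bilinear_br]
  bilinear_lzero[OF bilinear_br] bilinear_rzero[OF bilinear_br]
  bilinear_lsub[OF bilinear_br] bilinear_rsub[OF bilinear_br] br_self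

lemma br_swap: "br x y = - br y x"
proof -
  have "br x x + br x y + (br y x + br y y) = 0"
    using br_self[of "x + y"] by (simp add: br_simps(1,2) ac_simps)
  then show ?thesis
    by (simp add: br_self eq_neg_iff_add_eq_0)
qed

text \<open>The Jacobi identity as ad [x, y] = ad x ad y - ad y ad x, the form that the trace
  argument needs.\<close>

lemma br_br: "br (br x y) z = br x (br y z) - br y (br x z)"
  using jacobi[of x y z] br_swap[of z "br x y"] br_swap[of z x]
  by (simp add: br_simps algebra_simps eq_neg_iff_add_eq_0)

lemma br_in_derived: "br x y \<in> derived_algebra br"
  unfolding derived_algebra_def by (rule span_base) blast

lemma subspace_derived: "subspace (derived_algebra br)"
  unfolding derived_algebra_def by (rule subspace_span)

end

section \<open>Two-dimensional derived algebras\<close>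

lemma orthonormal_basis2_inner:
  assumes "orthonormal_basis2 S e1 e2"
  shows "e1 \<bullet> e1 = 1" "e2 \<bullet> e2 = 1" "e1 \<bullet> e2 = 0" "e2 \<bullet> e1 = 0" "e1 \<in> S" "e2 \<in> S"
  using assms unfolding orthonormal_basis2_def
  by (auto simp: orthogonal_def norm_eq_1 inner_commute intro: span_base)

lemma orthonormal_basis2_expand:
  assumes "orthonormal_basis2 S e1 e2" "z \<in> S"
  shows "z = (z \<bullet> e1) *\<^sub>R e1 + (z \<bullet> e2) *\<^sub>R e2"
proof -
  have "z \<in> span {e1, e2}"
    using assms by (simp add: orthonormal_basis2_def)
  then obtain a b where "z = a *\<^sub>R e1 + b *\<^sub>R e2"
    by (auto simp: span_insert algebra_simps eq_diff_eq)
  then show ?thesis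
    using orthonormal_basis2_inner[OF assms(1)] by (simp add: inner_add_left)
qed

lemma derived_algebra_abelian:
  fixes br :: "'a::real_inner \<Rightarrow> 'a \<Rightarrow> 'a"
  assumes "lie_algebra br" and onb: "orthonormal_basis2 (derived_algebra br) e1 e2"
    and x: "x \<in> derived_algebra br" and y: "y \<in> derived_algebra br"
  shows "br x y = 0"
proof -
  interpret lie_algebra br by fact
  note inn = orthonormal_basis2_inner[OF onb]
  have expand: "br v w = (br v w \<bullet> e1) *\<^sub>R e1 + (br v w \<bullet> e2) *\<^sub>R e2" for v w
    by (rule orthonormal_basis2_expand[OF onb br_in_derived])
  \<comment> \<open>\<open>t v\<close> is the trace of ad v on the derived algebra.
    \<open>comp\<close> is the matrix product in the basis, so \<open>t\<close> vanishes on
    commutators.\<close>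
  define t where "t v = br v e1 \<bullet> e1 + br v e2 \<bullet> e2" for v
  have comp: "br v (br w e) \<bullet> e' =
      (br w e \<bullet> e1) * (br v e1 \<bullet> e') + (br w e \<bullet> e2) * (br v e2 \<bullet> e')" for v w e e'
    by (subst expand[of w e]) (simp add: br_simps inner_add_left)
  have "t (br v w) = 0" for v w
    unfolding t_def br_br inner_diff_left comp by (simp add: algebra_simps)
  \<comment> \<open>The kernel of the linear form \<open>t\<close> contains all brackets, hence also
    their span.\<close>
  moreover have "subspace {v. t v = 0}"
    by (auto simp: subspace_def t_def br_simps inner_add_left simp flip: distrib_left)
  ultimately have "derived_algebra br \<subseteq> {v. t v = 0}"
    unfolding derived_algebra_def by (intro span_minimal) auto
  then have "t e1 = 0" "t e2 = 0"
    using inn by auto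
  \<comment> \<open>Since \<open>br e1 e1\<close> and \<open>br e2 e2\<close> vanish, each of the
    two traces is, up to sign, a single component of \<open>br e1 e2\<close>.\<close>
  then have "br e1 e2 \<bullet> e2 = 0" "br e1 e2 \<bullet> e1 = 0"
    using br_swap[of e2 e1] by (auto simp: t_def br_simps)
  then have 0: "br e1 e2 = 0" "br e2 e1 = 0"
    using expand[of e1 e2] br_swap[of e2 e1] by auto
  show ?thesis
    by (subst orthonormal_basis2_expand[OF onb x], subst orthonormal_basis2_expand[OF onb y])
       (simp add: br_simps 0)
qed

text \<open>That the derived algebra is abelian enters as an assumption, so that neither its
  dimension nor a basis occurs inside the locale.\<close>

locale type_II_hermitian = lie_algebra br
  for br :: "'a::euclidean_space \<Rightarrow> 'a \<Rightarrow> 'a" +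
  fixes J :: "'a \<Rightarrow> 'a"
  assumes hermitian: "hermitian br J"
    and type_II: "type_II br J"
    and abelian: "x \<in> derived_algebra br \<Longrightarrow> y \<in> derived_algebra br \<Longrightarrow> br x y = 0"
begin

section \<open>The orthogonal splitting into D, J D and W\<close>

abbreviation D where "D \<equiv> derived_algebra br"

text \<open>Since J is skew-adjoint, this is the orthogonal complement of D + J D.\<close>

definition W where "W = {u \<in> Gam br. J u \<in> Gam br}"

lemma linear_J: "linear J" and J_J: "J (J x) = - x" and J_inner: "J x \<bullet> J y = x \<bullet> y"
  and nijenhuis_0: "nijenhuis br J x y = 0"
  using hermitian by (auto simp: hermitian_def almost_complex_def)

lemmas J_simps = linear_add[OF linear_J] linear_diff[OF linear_J] linear_neg[OF linear_J]
  linear_0[OF linear_J] linear_cmul[OF linear_J] J_J J_inner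

lemma J_inner_left: "J x \<bullet> y = - (x \<bullet> J y)"
  using J_inner[of x "J y"] by (simp add: J_simps)

lemma J_derived: "x \<in> D \<Longrightarrow> J x \<in> Gam br"
  using type_II by (auto simp: type_II_def)

lemma subspace_Gam: "subspace (Gam br)"
  by (rule subspace_orthogonal_comp)

lemma inner_derived_Gam:
  assumes "x \<in> D" "u \<in> Gam br" shows "x \<bullet> u = 0" "u \<bullet> x = 0"
  using assms by (auto simp: orthogonal_comp_def orthogonal_def inner_commute)

text \<open>Type II makes D and J D orthogonal, and the isometry J is injective. This splits an
  equation in D + J D into two equations in D.\<close>

lemma derived_plus_J_derived_eq_0:
  assumes "x \<in> D" "y \<in> D" "x + J y = 0"
  shows "x = 0" "y = 0"
proof -
  have "x \<bullet> x = (x + J y) \<bullet> x"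
    using inner_derived_Gam[OF assms(1) J_derived[OF assms(2)]]
    by (simp add: inner_add_left)
  then show "x = 0"
    using assms(3) by simp
  then have "J y = 0"
    using assms by simp
  then show "y = 0"
    by (metis J_inner inner_eq_zero_iff)
qed

lemma W_D:
  assumes "u \<in> W" "x \<in> D"
  shows "u \<in> Gam br" "J u \<in> W" "u \<bullet> x = 0" "x \<bullet> u = 0" "J x \<bullet> u = 0" "u \<bullet> J x = 0"
proof -
  show u: "u \<in> Gam br"
    using assms by (simp add: W_def)
  show Ju: "J u \<in> W"
    using assms subspace_neg[OF subspace_Gam] by (simp add: W_def J_J)
  show "u \<bullet> x = 0" "x \<bullet> u = 0"
    using inner_derived_Gam[OF assms(2) u] by auto
  show "J x \<bullet> u = 0"
    using Ju inner_derived_Gam[OF assms(2), of "J u"] by (simp add: J_inner_left W_def)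
  then show "u \<bullet> J x = 0"
    by (simp add: inner_commute)
qed

text \<open>All brackets lie in D, so the vanishing of the Nijenhuis tensor is an equation in D + J
  D and splits.\<close>

lemma J_br: "br (J x) (J y) = br x y" "br (J x) y = - br x (J y)"
proof -
  have "br x y - br (J x) (J y) \<in> D" "br (J x) y + br x (J y) \<in> D"
    by (intro subspace_add[OF subspace_derived] subspace_diff[OF subspace_derived] br_in_derived)+
  moreover have "(br x y - br (J x) (J y)) + J (br (J x) y + br x (J y)) = 0"
    using nijenhuis_0[of x y] by (simp add: nijenhuis_def algebra_simps)
  ultimately have "br x y - br (J x) (J y) = 0" "br (J x) y + br x (J y) = 0"
    using derived_plus_J_derived_eq_0 by blast+
  then show "br (J x) (J y) = br x y" "br (J x) y = - br x (J y)"
    by (simp_all add: eq_neg_iff_add_eq_0)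
qed

lemma derived_Gam_decomp:
  obtains p v where "p \<in> D" "v \<in> Gam br" "x = p + v"
proof -
  obtain p v where "p \<in> span D" and v: "\<And>y. y \<in> span D \<Longrightarrow> orthogonal v y" and "x = p + v"
    using orthogonal_subspace_decomp_exists[of D x] by blast
  moreover have "v \<in> Gam br"
    using v by (auto simp: orthogonal_comp_def orthogonal_commute intro: span_base)
  ultimately show thesis
    using that by (simp add: span_eq_iff[THEN iffD2, OF subspace_derived])
qed

lemma decompose_Gam:
  assumes "v \<in> Gam br"
  obtains q u where "q \<in> D" "u \<in> W" "v = J q + u"
proof -
  \<comment> \<open>Projecting \<open>J v\<close> onto D and applying J again yields the J D part of
    \<open>v\<close>. The rest \<open>- J w\<close> stays in \<Gamma> as a difference of elements of
    \<Gamma>, and J sends it to \<open>w\<close>, so it lies in W.\<close>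
  obtain q w where q: "q \<in> D" and w: "w \<in> Gam br" and Jv: "J v = q + w"
    by (rule derived_Gam_decomp[of "J v"])
  have "- v = J q + J w"
    using J_J[of v] by (simp only: Jv linear_add[OF linear_J])
  then have "v = - (J q + J w)"
    by (metis minus_minus)
  then have v: "v = J (- q) + (- J w)"
    by (simp only: linear_neg[OF linear_J] minus_add_distrib)
  then have "- J w = v - J (- q)"
    by (simp only: add_diff_cancel_left')
  then have "- J w \<in> Gam br"
    using subspace_diff[OF subspace_Gam assms J_derived] subspace_neg[OF subspace_derived q] by simp
  then have "- J w \<in> W"
    using w by (simp add: W_def J_simps)
  then show thesis
    using that[OF subspace_neg[OF subspace_derived q] _ v] by simp
qed

lemma decompose:
  obtains p q u where "p \<in> D" "q \<in> D" "u \<in> W" "x = p + J q + u"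
proof -
  obtain p v where p: "p \<in> D" and v: "v \<in> Gam br" and x: "x = p + v"
    by (rule derived_Gam_decomp[of x])
  obtain q u where "q \<in> D" "u \<in> W" "v = J q + u"
    using decompose_Gam[OF v] .
  then show thesis
    using that[OF p] x by (simp add: add.assoc)
qed

lemma br_J_swap: "p \<in> D \<Longrightarrow> q \<in> D \<Longrightarrow> br (J p) q = br (J q) p"
  by (metis J_br(2) br_swap)

lemma J_br_derived:
  assumes "p \<in> D" "q \<in> D" shows "br (J p) (J q) = 0"
  by (simp add: J_br(1) abelian[OF assms])

lemma kaehler_iff:
  "kaehler br J \<longleftrightarrow> (\<forall>u\<in>Gam br. \<forall>v\<in>Gam br. br u v = 0) \<and>
     (\<forall>u\<in>Gam br. \<forall>p\<in>D. \<forall>q\<in>D. br u p \<bullet> q = br u q \<bullet> p)"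
proof (intro iffI conjI ballI)
  assume "kaehler br J"
  then have closed: "J (br x y) \<bullet> z + J (br y z) \<bullet> x + J (br z x) \<bullet> y = 0" for x y z
    by (simp only: kaehler_def ext_deriv2_def fundamental_form_def neg_equal_0_iff_equal)
  \<comment> \<open>A bracket lies in D, so it can be tested against itself.\<close>
  have eq_0: "br x y = 0" if "\<And>r. r \<in> D \<Longrightarrow> br x y \<bullet> r = 0" for x y
    using that[OF br_in_derived[of x y]] by simp
  have JD: "J (br x y) \<bullet> p = 0" if "p \<in> D" for x y p
    using inner_derived_Gam that J_derived br_in_derived by blast
  have WD: "br p u = 0" if "p \<in> D" "u \<in> W" for p u
  proof (rule eq_0)
    fix r assume r: "r \<in> D"
    \<comment> \<open>For the triple (u, J r, p) the other two terms vanish: one pairs J D with D,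
      the other J D with W.\<close>
    show "br p u \<bullet> r = 0"
      using closed[of u "J r" p] JD[OF that(1)] W_D(5)[OF that(2) br_in_derived]
      by (simp add: J_inner)
  qed
  have JDW: "br (J p) u = 0" if "p \<in> D" "u \<in> W" for p u
    using WD[OF that(1) W_D(2)[OF that(2) that(1)]] by (simp add: J_br(2))
  have WW: "br u v = 0" if "u \<in> W" "v \<in> W" for u v
  proof (rule eq_0)
    fix r assume r: "r \<in> D"
    \<comment> \<open>For the triple (u, v, J r) the other two terms pair J D with W.\<close>
    show "br u v \<bullet> r = 0"
      using closed[of u v "J r"] W_D(5)[OF that(1) br_in_derived] W_D(5)[OF that(2) br_in_derived]
      by (simp add: J_inner)
  qed
  have WJD: "br u (J p) = 0" "br u p = 0" if "p \<in> D" "u \<in> W" for p u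
    using JDW[OF that] WD[OF that] br_swap[of u "J p"] br_swap[of u p] by auto
  show "br v w = 0" if v: "v \<in> Gam br" and w: "w \<in> Gam br" for v w
  proof -
    obtain q u where "q \<in> D" "u \<in> W" "v = J q + u"
      using decompose_Gam[OF v] .
    moreover obtain q' u' where "q' \<in> D" "u' \<in> W" "w = J q' + u'"
      using decompose_Gam[OF w] .
    ultimately show ?thesis
      by (simp add: br_simps J_br_derived JDW WW WJD)
  qed
  show "br v p \<bullet> q = br v q \<bullet> p" if v_Gam: "v \<in> Gam br" and pq: "p \<in> D" "q \<in> D" for v p q
  proof -
    \<comment> \<open>The triple (J q, J r, p) lets the outer arguments of the trilinear form
      \<open>br (J r) p \<bullet> q\<close> be exchanged. With \<open>br_J_swap\<close> for the
      first two, the form is totally symmetric on D.\<close>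
    have sym: "br (J r) p \<bullet> q = br (J q) p \<bullet> r" if "r \<in> D" "p \<in> D" "q \<in> D" for p q r
      using closed[of "J q" "J r" p] JD[OF that(2)] br_swap[of p "J q"]
      by (simp add: J_simps br_simps J_inner)
    obtain r u where r: "r \<in> D" and u: "u \<in> W" and v: "v = J r + u"
      using decompose_Gam[OF v_Gam] .
    have "br (J r) p \<bullet> q = br (J r) q \<bullet> p"
      using sym br_J_swap r pq by metis
    then show ?thesis
      using WJD(2)[OF _ u] pq by (simp add: v br_simps)
  qed
next
  assume *: "(\<forall>u\<in>Gam br. \<forall>v\<in>Gam br. br u v = 0) \<and>
     (\<forall>u\<in>Gam br. \<forall>p\<in>D. \<forall>q\<in>D. br u p \<bullet> q = br u q \<bullet> p)"
  \<comment> \<open>On D the form \<open>T\<close> is totally symmetric: integrability exchanges the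
    first two arguments, symmetry of ad (J q) the last two.\<close>
  define T where "T q p r = br (J q) p \<bullet> r" for q p r
  have T_swap: "T q p r = T p q r" "T q p r = T q r p" if "p \<in> D" "q \<in> D" "r \<in> D" for p q r
    using * J_derived br_J_swap that by (simp_all add: T_def)
  \<comment> \<open>By integrability [u, p] = [J u, J p], a bracket of two elements of
    \<Gamma>.\<close>
  have WD: "br u p = 0" if "p \<in> D" "u \<in> W" for p u
    using * J_br(2)[of "J u" p] W_D(1)[OF W_D(2)[OF that(2) that(1)] that(1)] J_derived[OF that(1)]
    by (simp add: J_simps br_simps)
  have DW: "br p u = 0" if "p \<in> D" "u \<in> W" for p u
    using WD[OF that] br_swap[of p u] by simp
  \<comment> \<open>Only the brackets between D and J D survive.\<close>
  have br_eq: "br (p + J q + u) (p' + J q' + u') = br (J q) p' - br (J q') p"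
    if "p \<in> D" "q \<in> D" "u \<in> W" "p' \<in> D" "q' \<in> D" "u' \<in> W" for p q u p' q' u'
  proof -
    have "br (J q + u) (J q' + u') = 0"
      using * that J_derived W_D(1) subspace_add[OF subspace_Gam] by blast
    then show ?thesis
      using that abelian[of p p'] br_swap[of p "J q'"] by (simp add: br_simps WD DW algebra_simps)
  qed
  \<comment> \<open>J maps the bracket into J D, so the pairing sees only the component
    \<open>J q''\<close>.\<close>
  have form: "J (br (p + J q + u) (p' + J q' + u')) \<bullet> (p'' + J q'' + u'') = T q p' q'' - T q' p q''"
    if "p \<in> D" "q \<in> D" "u \<in> W" "p' \<in> D" "q' \<in> D" "u' \<in> W" "p'' \<in> D" "q'' \<in> D" "u'' \<in> W"
    for p q u p' q' u' p'' q'' u''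
  proof -
    let ?r = "br (J q) p' - br (J q') p"
    have "?r \<in> D"
      by (intro subspace_diff[OF subspace_derived] br_in_derived)
    then have "J ?r \<bullet> (p'' + J q'' + u'') = ?r \<bullet> q''"
      using W_D(5)[OF that(9)] inner_derived_Gam(2)[OF that(7) J_derived]
      by (simp add: inner_add_right J_inner)
    then show ?thesis
      by (simp add: br_eq that T_def inner_diff_left)
  qed
  have "J (br x y) \<bullet> z + J (br y z) \<bullet> x + J (br z x) \<bullet> y = 0" for x y z
  proof -
    obtain p q u where x: "p \<in> D" "q \<in> D" "u \<in> W" "x = p + J q + u"
      by (rule decompose)
    obtain p' q' u' where y: "p' \<in> D" "q' \<in> D" "u' \<in> W" "y = p' + J q' + u'"
      by (rule decompose)
    obtain p'' q'' u'' where z: "p'' \<in> D" "q'' \<in> D" "u'' \<in> W" "z = p'' + J q'' + u''"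
      by (rule decompose)
    \<comment> \<open>The cyclic sum has six terms; each identity exchanges outer arguments and
      cancels a pair of opposite sign.\<close>
    have "T q p' q'' = T q'' p' q" "T q' p q'' = T q'' p q'" "T q' p'' q = T q p'' q'"
      using T_swap x y z by metis+
    then show ?thesis
      by (simp add: x y z form)
  qed
  then show "kaehler br J"
    using hermitian by (simp add: kaehler_def ext_deriv2_def fundamental_form_def)
qed

end

section \<open>Translation into the structure data\<close>

theorem theorem3p3:
  fixes br :: "'a::euclidean_space \<Rightarrow> 'a \<Rightarrow> 'a"
    and J f1 f2 :: "'a \<Rightarrow> 'a"
    and e1 e2 a1 a2 b1 b2 :: 'a
  assumes "DIM('a) \<ge> 3"
    and "lie_algebra br"
    and "dim (derived_algebra br) = 2"
    and "hermitian br J"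
    and "type_II br J"
    and "orthonormal_basis2 (derived_algebra br) e1 e2"
    and "structure_data br e1 e2 a1 a2 b1 b2 f1 f2"
  shows "kaehler br J \<longleftrightarrow> (\<forall>u\<in>Gam br. f1 u = 0 \<and> f2 u = 0) \<and> b1 = a2"
proof -
  interpret lie_algebra br by fact
  interpret type_II_hermitian br J
    by unfold_locales (use assms derived_algebra_abelian[OF assms(2,6)] in auto)
  note onb = assms(6)
  note inn = orthonormal_basis2_inner[OF onb]
  have Gam: "a2 \<in> Gam br" "b1 \<in> Gam br"
    and f_Gam: "\<And>u. u \<in> Gam br \<Longrightarrow> f1 u \<in> Gam br" "\<And>u. u \<in> Gam br \<Longrightarrow> f2 u \<in> Gam br"
    and br_e1: "\<And>u. u \<in> Gam br \<Longrightarrow> br u e1 = (a1 \<bullet> u) *\<^sub>R e1 + (a2 \<bullet> u) *\<^sub>R e2"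
    and br_e2: "\<And>u. u \<in> Gam br \<Longrightarrow> br u e2 = (b1 \<bullet> u) *\<^sub>R e1 + (b2 \<bullet> u) *\<^sub>R e2"
    and br_Gam: "\<And>u v. u \<in> Gam br \<Longrightarrow> v \<in> Gam br \<Longrightarrow>
      br u v = (f1 u \<bullet> v) *\<^sub>R e1 + (f2 u \<bullet> v) *\<^sub>R e2"
    using assms(7) by (auto simp: structure_data_def skew_adjoint_on_def)
  have "(\<forall>u\<in>Gam br. \<forall>v\<in>Gam br. br u v = 0) \<longleftrightarrow> (\<forall>u\<in>Gam br. f1 u = 0 \<and> f2 u = 0)"
  proof
    assume *: "\<forall>u\<in>Gam br. \<forall>v\<in>Gam br. br u v = 0"
    have "f1 u \<bullet> v = 0" "f2 u \<bullet> v = 0" if "u \<in> Gam br" "v \<in> Gam br" for u v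
    proof -
      have "br u v \<bullet> e1 = f1 u \<bullet> v" "br u v \<bullet> e2 = f2 u \<bullet> v"
        using br_Gam[OF that] inn by (simp_all add: inner_add_left)
      then show "f1 u \<bullet> v = 0" "f2 u \<bullet> v = 0"
        using * that by simp_all
    qed
    \<comment> \<open>\<open>f1 u\<close> and \<open>f2 u\<close> lie in \<Gamma>, so each can be
      tested against itself.\<close>
    then show "\<forall>u\<in>Gam br. f1 u = 0 \<and> f2 u = 0"
      using f_Gam inner_eq_zero_iff by metis
  qed (simp add: br_Gam)
  moreover have "(\<forall>u\<in>Gam br. \<forall>p\<in>D. \<forall>q\<in>D. br u p \<bullet> q = br u q \<bullet> p) \<longleftrightarrow> b1 = a2"
  proof
    assume *: "\<forall>u\<in>Gam br. \<forall>p\<in>D. \<forall>q\<in>D. br u p \<bullet> q = br u q \<bullet> p"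
    have "b1 \<bullet> u = a2 \<bullet> u" if "u \<in> Gam br" for u
    proof -
      \<comment> \<open>The off-diagonal entries of ad u on D are \<open>a2 \<bullet> u\<close> and
        \<open>b1 \<bullet> u\<close>.\<close>
      have "br u e1 \<bullet> e2 = br u e2 \<bullet> e1"
        using * that inn by simp
      then show ?thesis
        using br_e1[OF that] br_e2[OF that] inn by (simp add: inner_add_left)
    qed
    then have "(b1 - a2) \<bullet> (b1 - a2) = 0"
      using subspace_diff[OF subspace_Gam Gam(2,1)] by (simp add: inner_diff_left)
    then show "b1 = a2"
      by simp
  next
    assume eq: "b1 = a2"
    show "\<forall>u\<in>Gam br. \<forall>p\<in>D. \<forall>q\<in>D. br u p \<bullet> q = br u q \<bullet> p"
    proof (intro ballI)
      fix u p q assume u: "u \<in> Gam br" and p: "p \<in> D" and q: "q \<in> D"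
      \<comment> \<open>Expanding in the orthonormal basis reduces symmetry of ad u to equality of
        its off-diagonal entries.\<close>
      have ad: "br u p = (p \<bullet> e1) *\<^sub>R br u e1 + (p \<bullet> e2) *\<^sub>R br u e2" if "p \<in> D" for p
        by (subst orthonormal_basis2_expand[OF onb that]) (simp add: br_simps)
      show "br u p \<bullet> q = br u q \<bullet> p"
        by (simp add: ad p q br_e1[OF u] br_e2[OF u] eq inner_add_left inner_commute[of _ p]
            inner_commute[of _ q] algebra_simps)
    qed
  qed
  ultimately show ?thesis
    by (simp add: kaehler_iff)
qed

end
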